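(* Let $X$ be a $\check C_0$-complete $\mathbf r$-exterior flow. Then: (i) $L(X)$ is a global weak attractor of $X$ and $L(X)=C(X)$. (ii) If $X$ is Hausdorff, then $L(X)$ is the unique minimal global attractor of $X$ and $L(X)=\overline{\Omega^{\mathbf r}(X)}$.
   Context: Exterior spaces: an exterior space is a topological space $X$ together with a nonempty family $\varepsilon(X)$ of open subsets (an externology; its members are called exterior open subsets) closed under finite intersections and such that if $E\in\varepsilon(X)$, $U$ is open and $E\subset U$, then $U\in\varepsilon(X)$. A map is exterior if it is continuous and preimages of exterior open subsets are exterior open; $\mathbf E$ is the resulting category. For an exterior space $X$ and a topological space $Y$, $X\bar\times Y$ is $X\times Y$ with the product topology and the externology of those open $E$ such that for each $y\in Y$ there are an open neighbourhood $U_y$ of $y$ and $T^y\in\varepsilon(X)$ with $T^y\times U_y\subset E$. $I=[0,1]$. $\mathbb R^{\mathbf r}$ is $\mathbb R$ with externology $\mathbf r=\{U \text{ open}: (n,+\infty)\subset U\text{ for some } n\in\mathbb N\}$. For an exterior space $M$, $M_{\mathbf t}$ is the underlying topological space and $M_{\mathbf d}$ the underlying set with the discrete topology. An $\mathbf r$-exterior flow is an exterior space $M$ with a flow $\varphi\colon\mathbb R\times M_{\mathbf t}\to M_{\mathbf t}$, $\varphi(t,x)=t\cdot x$ (a continuous action of the additive group $\mathbb R$) such that $\varphi\colon\mathbb R^{\mathbf r}\bar\times M_{\mathbf d}\to M$ is exterior and, for every $t\in\mathbb R$, $F_t\colon M\bar\times I\to M$, $F_t(x,s)=\varphi(ts,x)$,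 is exterior. Limit and end spaces: for a space $Y$, $\pi_0(Y)$ is the set of path-components with the quotient topology of $q_0\colon Y\to\pi_0(Y)$. $L(X)=\bigcap_{E\in\varepsilon(X)}E$ (subspace topology); $\check\pi_0(X)=\lim_{E\in\varepsilon(X)}\pi_0(E)$ (inverse limit topology), with projections $\eta_{0,E}\colon\check\pi_0(X)\to\pi_0(E)$; $e_0\colon L(X)\to\check\pi_0(X)$ sends $x$ to the family of path-components of $x$ in the sets $E$. Completion: $\check C_0(X)$ has underlying set the push-out $X\cup_{L(X)}\check\pi_0(X)$ of the inclusion $L(X)\to X$ and $e_0$, with canonical maps $p_0\colon X\to\check C_0(X)$, $\operatorname{in}_0\colon\check\pi_0(X)\to\check C_0(X)$. A subset $W$ is open iff (a) $p_0^{-1}(W)$ and $\operatorname{in}_0^{-1}(W)$ are open, and (b) for each $a\in\operatorname{in}_0^{-1}(W)$ there are $E\in\varepsilon(X)$ and an open $G\subset\pi_0(E)$ with $a\in\eta_{0,E}^{-1}(G)\subset\operatorname{in}_0^{-1}(W)$ and $q_0^{-1}(G)\subset p_0^{-1}(W)$. Its externology is $\{W_0(E): E\in\varepsilon(X)\}$ with $W_0(E)=p_0(E)\cup\operatorname{in}_0(\check\pi_0(X))$. $X$ is $\check C_0$-complete if $p_0\colon X\to\check C_0(X)$ is an isomorphism in $\mathbf E$. Dynamics: $\omega^{\mathbf r}(x)=\bigcap_{t\ge0}\overline{[t,+\infty)\cdot x}$, $\Omega^{\mathbf r}(X)=\bigcup_x\omega^{\mathbf r}(x)$; $C(X)$ is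 the set of critical points ($t\cdot x=x$ for all $t$). An invariant subspace $M\subset X$ is a global weak attractor if $\omega^{\mathbf r}(x)\cap M\neq\emptyset$ for every $x\in X$, and a global attractor if $\omega^{\mathbf r}(x)\neq\emptyset$ and $\omega^{\mathbf r}(x)\subset M$ for every $x\in X$. Minimality is with respect to inclusion. *)

theory Defs
  imports "HOL-Analysis.Analysis"
begin

section \<open>Exterior spaces\<close>

record 'a exterior =
  etop :: "'a topology"
  exts :: "'a set set"

definition exterior_space :: "'a exterior \<Rightarrow> bool" where
  "exterior_space X \<longleftrightarrow>
     exts X \<noteq> {} \<and>
     (\<forall>E \<in> exts X. openin (etop X) E) \<and>
     (\<forall>E \<in> exts X. \<forall>F \<in> exts X. E \<inter> F \<in> exts X) \<and>
     (\<forall>E \<in> exts X. \<forall>U. openin (etop X) U \<and> E \<subseteq> U \<longrightarrow> U \<in> exts X)"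

lemma exterior_space_openin: "exterior_space X \<Longrightarrow> E \<in> exts X \<Longrightarrow> openin (etop X) E"
  unfolding exterior_space_def by (elim conjE) (rule bspec)

lemma exterior_space_Int:
  "exterior_space X \<Longrightarrow> E \<in> exts X \<Longrightarrow> F \<in> exts X \<Longrightarrow> E \<inter> F \<in> exts X"
  unfolding exterior_space_def by (elim conjE) (drule (1) bspec, drule (1) bspec, assumption)

definition exterior_map :: "'a exterior \<Rightarrow> 'b exterior \<Rightarrow> ('a \<Rightarrow> 'b) \<Rightarrow> bool" where
  "exterior_map X Y f \<longleftrightarrow>
     continuous_map (etop X) (etop Y) f \<and>
     (\<forall>E \<in> exts Y. {x \<in> topspace (etop X). f x \<in> E} \<in> exts X)"

definition exterior_iso :: "'a exterior \<Rightarrow> 'b exterior \<Rightarrow> ('a \<Rightarrow> 'b) \<Rightarrow> bool" where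
  "exterior_iso X Y f \<longleftrightarrow>
     exterior_map X Y f \<and>
     (\<exists>g. exterior_map Y X g \<and>
        (\<forall>x \<in> topspace (etop X). g (f x) = x) \<and>
        (\<forall>y \<in> topspace (etop Y). f (g y) = y))"

definition bar_prod :: "'a exterior \<Rightarrow> 'b topology \<Rightarrow> ('a \<times> 'b) exterior" where
  "bar_prod X Y =
     \<lparr>etop = prod_topology (etop X) Y,
      exts = {E. openin (prod_topology (etop X) Y) E \<and>
        (\<forall>y \<in> topspace Y. \<exists>U T. openin Y U \<and> y \<in> U \<and> T \<in> exts X \<and> T \<times> U \<subseteq> E)}\<rparr>"

definition R_r :: "real exterior" where
  "R_r = \<lparr>etop = euclideanreal, exts = {U. open U \<and> (\<exists>n::nat. {real n<..} \<subseteq> U)}\<rparr>"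


section \<open>Flows\<close>

definition flow :: "'a topology \<Rightarrow> (real \<Rightarrow> 'a \<Rightarrow> 'a) \<Rightarrow> bool" where
  "flow X \<phi> \<longleftrightarrow>
     continuous_map (prod_topology euclideanreal X) X (\<lambda>(t, x). \<phi> t x) \<and>
     (\<forall>x \<in> topspace X. \<phi> 0 x = x) \<and>
     (\<forall>s t. \<forall>x \<in> topspace X. \<phi> (s + t) x = \<phi> s (\<phi> t x))"

definition r_exterior_flow :: "'a exterior \<Rightarrow> (real \<Rightarrow> 'a \<Rightarrow> 'a) \<Rightarrow> bool" where
  "r_exterior_flow M \<phi> \<longleftrightarrow>
     exterior_space M \<and>
     flow (etop M) \<phi> \<and>
     exterior_map (bar_prod R_r (discrete_topology (topspace (etop M)))) M (\<lambda>(t, x). \<phi> t x) \<and>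
     (\<forall>t. exterior_map (bar_prod M (top_of_set {0..1::real})) M (\<lambda>(x, s). \<phi> (t * s) x))"

definition omega_r :: "'a topology \<Rightarrow> (real \<Rightarrow> 'a \<Rightarrow> 'a) \<Rightarrow> 'a \<Rightarrow> 'a set" where
  "omega_r X \<phi> x = (\<Inter>t \<in> {0..}. X closure_of ((\<lambda>s. \<phi> s x) ` {t..}))"

definition Omega_r :: "'a topology \<Rightarrow> (real \<Rightarrow> 'a \<Rightarrow> 'a) \<Rightarrow> 'a set" where
  "Omega_r X \<phi> = (\<Union>x \<in> topspace X. omega_r X \<phi> x)"

definition critical_points :: "'a topology \<Rightarrow> (real \<Rightarrow> 'a \<Rightarrow> 'a) \<Rightarrow> 'a set" where
  "critical_points X \<phi> = {x \<in> topspace X. \<forall>t. \<phi> t x = x}"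

definition invariant_subspace :: "'a topology \<Rightarrow> (real \<Rightarrow> 'a \<Rightarrow> 'a) \<Rightarrow> 'a set \<Rightarrow> bool" where
  "invariant_subspace X \<phi> M \<longleftrightarrow> M \<subseteq> topspace X \<and> (\<forall>t. \<forall>x \<in> M. \<phi> t x \<in> M)"

definition global_weak_attractor :: "'a topology \<Rightarrow> (real \<Rightarrow> 'a \<Rightarrow> 'a) \<Rightarrow> 'a set \<Rightarrow> bool" where
  "global_weak_attractor X \<phi> M \<longleftrightarrow>
     invariant_subspace X \<phi> M \<and> (\<forall>x \<in> topspace X. omega_r X \<phi> x \<inter> M \<noteq> {})"

definition global_attractor :: "'a topology \<Rightarrow> (real \<Rightarrow> 'a \<Rightarrow> 'a) \<Rightarrow> 'a set \<Rightarrow> bool" where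
  "global_attractor X \<phi> M \<longleftrightarrow>
     invariant_subspace X \<phi> M \<and>
     (\<forall>x \<in> topspace X. omega_r X \<phi> x \<noteq> {} \<and> omega_r X \<phi> x \<subseteq> M)"

definition minimal_global_attractor :: "'a topology \<Rightarrow> (real \<Rightarrow> 'a \<Rightarrow> 'a) \<Rightarrow> 'a set \<Rightarrow> bool" where
  "minimal_global_attractor X \<phi> M \<longleftrightarrow>
     global_attractor X \<phi> M \<and> (\<forall>N. global_attractor X \<phi> N \<and> N \<subseteq> M \<longrightarrow> N = M)"


section \<open>Path-components, limit space and end space\<close>

abbreviation q0 :: "'a topology \<Rightarrow> 'a \<Rightarrow> 'a set" where
  "q0 Y x \<equiv> path_component_of_set Y x"

definition pi0 :: "'a topology \<Rightarrow> 'a set topology" where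
  "pi0 Y = topology (\<lambda>G. G \<subseteq> path_components_of Y \<and> openin Y {x \<in> topspace Y. q0 Y x \<in> G})"

lemma openin_pi0:
  "openin (pi0 Y) G \<longleftrightarrow> G \<subseteq> path_components_of Y \<and> openin Y {x \<in> topspace Y. q0 Y x \<in> G}"
proof -
  have "istopology (\<lambda>G. G \<subseteq> path_components_of Y \<and> openin Y {x \<in> topspace Y. q0 Y x \<in> G})"
    unfolding istopology_def
  proof (rule conjI; clarify)
    fix S T
    assume "S \<subseteq> path_components_of Y" "openin Y {x \<in> topspace Y. q0 Y x \<in> S}"
      and "openin Y {x \<in> topspace Y. q0 Y x \<in> T}"
    moreover have "{x \<in> topspace Y. q0 Y x \<in> S \<inter> T} =
        {x \<in> topspace Y. q0 Y x \<in> S} \<inter> {x \<in> topspace Y. q0 Y x \<in> T}"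
      by auto
    ultimately show "S \<inter> T \<subseteq> path_components_of Y \<and> openin Y {x \<in> topspace Y. q0 Y x \<in> S \<inter> T}"
      by (auto intro: openin_Int)
  next
    fix \<K>
    assume K: "\<forall>K\<in>\<K>. K \<subseteq> path_components_of Y \<and> openin Y {x \<in> topspace Y. q0 Y x \<in> K}"
    have "{x \<in> topspace Y. q0 Y x \<in> \<Union>\<K>} = (\<Union>K\<in>\<K>. {x \<in> topspace Y. q0 Y x \<in> K})"
      by auto
    moreover have "openin Y (\<Union>K\<in>\<K>. {x \<in> topspace Y. q0 Y x \<in> K})"
      using K by blast
    ultimately show "\<Union>\<K> \<subseteq> path_components_of Y \<and> openin Y {x \<in> topspace Y. q0 Y x \<in> \<Union>\<K>}"
      using K by auto
  qed
  then show ?thesis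
    unfolding pi0_def by (simp add: topology_inverse')
qed

lemma topspace_pi0 [simp]: "topspace (pi0 Y) = path_components_of Y"
proof
  show "topspace (pi0 Y) \<subseteq> path_components_of Y"
    using openin_pi0 openin_topspace by blast
  have "{x \<in> topspace Y. q0 Y x \<in> path_components_of Y} = topspace Y"
    by (auto simp: path_components_of_def)
  then have "openin (pi0 Y) (path_components_of Y)"
    by (simp add: openin_pi0)
  then show "path_components_of Y \<subseteq> topspace (pi0 Y)"
    by (rule openin_subset)
qed

lemma quotient_map_q0: "quotient_map Y (pi0 Y) (q0 Y)"
  unfolding quotient_map_def by (auto simp: openin_pi0 path_components_of_def)

definition limit_space :: "'a exterior \<Rightarrow> 'a set" where
  "limit_space X = \<Inter> (exts X)"

abbreviation pi0_at :: "'a exterior \<Rightarrow> 'a set \<Rightarrow> 'a set topology" where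
  "pi0_at X E \<equiv> pi0 (subtopology (etop X) E)"

abbreviation q0_at :: "'a exterior \<Rightarrow> 'a set \<Rightarrow> 'a \<Rightarrow> 'a set" where
  "q0_at X E \<equiv> q0 (subtopology (etop X) E)"

text \<open>For \<open>E \<subseteq> F\<close> the bonding map \<open>\<pi>\<^sub>0(E) \<rightarrow> \<pi>\<^sub>0(F)\<close> sends the path-component of \<open>x\<close> in \<open>E\<close>
  to the path-component of \<open>x\<close> in \<open>F\<close>; the last condition says that it maps \<open>a E\<close> to \<open>a F\<close>.
  The projection \<open>\<eta>\<^sub>0\<^sub>,\<^sub>E\<close> is \<open>\<lambda>a. a E\<close>.\<close>

definition end_space :: "'a exterior \<Rightarrow> ('a set \<Rightarrow> 'a set) topology" where
  "end_space X =
     subtopology (product_topology (pi0_at X) (exts X))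
       {a. \<forall>E \<in> exts X. \<forall>F \<in> exts X. E \<subseteq> F \<longrightarrow> (\<forall>x \<in> a E. q0_at X F x = a F)}"

definition e0 :: "'a exterior \<Rightarrow> 'a \<Rightarrow> ('a set \<Rightarrow> 'a set)" where
  "e0 X x = (\<lambda>E \<in> exts X. q0_at X E x)"


section \<open>The completion\<close>

text \<open>The push-out is the quotient of the disjoint sum of \<open>X\<close> and the end space by the
  equivalence relation generated by \<open>Inl x \<sim> Inr (e0 X x)\<close> for \<open>x\<close> in the limit space;
  its points are the equivalence classes.\<close>

definition glue :: "'a exterior \<Rightarrow> 'a + ('a set \<Rightarrow> 'a set) \<Rightarrow> 'a + ('a set \<Rightarrow> 'a set) \<Rightarrow> bool" where
  "glue X = equivclp (\<lambda>u v. \<exists>x \<in> limit_space X. u = Inl x \<and> v = Inr (e0 X x))"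

type_synonym 'a completion_point = "('a + ('a set \<Rightarrow> 'a set)) set"

definition p0 :: "'a exterior \<Rightarrow> 'a \<Rightarrow> 'a completion_point" where
  "p0 X x = Collect (glue X (Inl x))"

definition in0 :: "'a exterior \<Rightarrow> ('a set \<Rightarrow> 'a set) \<Rightarrow> 'a completion_point" where
  "in0 X a = Collect (glue X (Inr a))"

definition completion_carrier :: "'a exterior \<Rightarrow> 'a completion_point set" where
  "completion_carrier X = p0 X ` topspace (etop X) \<union> in0 X ` topspace (end_space X)"

definition p0_pre :: "'a exterior \<Rightarrow> 'a completion_point set \<Rightarrow> 'a set" where
  "p0_pre X W = {x \<in> topspace (etop X). p0 X x \<in> W}"

definition in0_pre :: "'a exterior \<Rightarrow> 'a completion_point set \<Rightarrow> ('a set \<Rightarrow> 'a set) set" where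
  "in0_pre X W = {a \<in> topspace (end_space X). in0 X a \<in> W}"

definition completion_open :: "'a exterior \<Rightarrow> 'a completion_point set \<Rightarrow> bool" where
  "completion_open X W \<longleftrightarrow>
     W \<subseteq> completion_carrier X \<and>
     openin (etop X) (p0_pre X W) \<and> openin (end_space X) (in0_pre X W) \<and>
     (\<forall>a \<in> in0_pre X W. \<exists>E \<in> exts X. \<exists>G. openin (pi0_at X E) G \<and>
        a \<in> {b \<in> topspace (end_space X). b E \<in> G} \<and>
        {b \<in> topspace (end_space X). b E \<in> G} \<subseteq> in0_pre X W \<and>
        {x \<in> E. q0_at X E x \<in> G} \<subseteq> p0_pre X W)"

definition C0_completion :: "'a exterior \<Rightarrow> 'a completion_point exterior" where
  "C0_completion X =
     \<lparr>etop = topology (completion_open X),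
      exts = {p0 X ` E \<union> in0 X ` topspace (end_space X) | E. E \<in> exts X}\<rparr>"

definition C0_complete :: "'a exterior \<Rightarrow> bool" where
  "C0_complete X \<longleftrightarrow> exterior_iso X (C0_completion X) (p0 X)"

text \<open>The sets declared open in \<^const>\<open>C0_completion\<close> do form a topology, so that
  \<^const>\<open>topology\<close> is not applied outside its domain.\<close>

lemma end_space_proj:
  assumes "a \<in> topspace (end_space X)" "E \<in> exts X"
  shows "a E \<in> path_components_of (subtopology (etop X) E)"
  using assms by (auto simp: end_space_def)

lemma end_space_compat:
  assumes "a \<in> topspace (end_space X)" "E \<in> exts X" "F \<in> exts X" "E \<subseteq> F" "x \<in> a E"
  shows "q0_at X F x = a F"
  using assms by (auto simp: end_space_def)

lemma completion_openE:
  assumes "completion_open X W" "a \<in> in0_pre X W"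
  obtains E G where "E \<in> exts X" "openin (pi0_at X E) G"
    "a \<in> {b \<in> topspace (end_space X). b E \<in> G}"
    "{b \<in> topspace (end_space X). b E \<in> G} \<subseteq> in0_pre X W"
    "{x \<in> E. q0_at X E x \<in> G} \<subseteq> p0_pre X W"
proof -
  have "\<forall>a \<in> in0_pre X W. \<exists>E \<in> exts X. \<exists>G. openin (pi0_at X E) G \<and>
        a \<in> {b \<in> topspace (end_space X). b E \<in> G} \<and>
        {b \<in> topspace (end_space X). b E \<in> G} \<subseteq> in0_pre X W \<and>
        {x \<in> E. q0_at X E x \<in> G} \<subseteq> p0_pre X W"
    using assms(1) unfolding completion_open_def by (elim conjE)
  from bspec[OF this assms(2)] show thesis
    using that by (elim bexE exE conjE)
qed

lemma istopology_completion_open: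
  assumes X: "exterior_space X"
  shows "istopology (completion_open X)"
  unfolding istopology_def
proof (intro conjI allI impI)
  fix S T
  assume S: "completion_open X S" and T: "completion_open X T"
  have p: "p0_pre X (S \<inter> T) = p0_pre X S \<inter> p0_pre X T"
    and i: "in0_pre X (S \<inter> T) = in0_pre X S \<inter> in0_pre X T"
    by (auto simp: p0_pre_def in0_pre_def)
  have "\<exists>E \<in> exts X. \<exists>G. openin (pi0_at X E) G \<and>
        a \<in> {b \<in> topspace (end_space X). b E \<in> G} \<and>
        {b \<in> topspace (end_space X). b E \<in> G} \<subseteq> in0_pre X (S \<inter> T) \<and>
        {x \<in> E. q0_at X E x \<in> G} \<subseteq> p0_pre X (S \<inter> T)"
    if a: "a \<in> in0_pre X (S \<inter> T)" for a
  proof -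
    from a i have aS: "a \<in> in0_pre X S" and aT: "a \<in> in0_pre X T"
      by auto
    obtain E1 G1 where 1: "E1 \<in> exts X" "openin (pi0_at X E1) G1"
        "a \<in> {b \<in> topspace (end_space X). b E1 \<in> G1}"
        "{b \<in> topspace (end_space X). b E1 \<in> G1} \<subseteq> in0_pre X S"
        "{x \<in> E1. q0_at X E1 x \<in> G1} \<subseteq> p0_pre X S"
      by (rule completion_openE[OF S aS])
    obtain E2 G2 where 2: "E2 \<in> exts X" "openin (pi0_at X E2) G2"
        "a \<in> {b \<in> topspace (end_space X). b E2 \<in> G2}"
        "{b \<in> topspace (end_space X). b E2 \<in> G2} \<subseteq> in0_pre X T"
        "{x \<in> E2. q0_at X E2 x \<in> G2} \<subseteq> p0_pre X T"
      by (rule completion_openE[OF T aT])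
    define E where "E = E1 \<inter> E2"
    have E: "E \<in> exts X" "E \<subseteq> E1" "E \<subseteq> E2"
      using exterior_space_Int[OF X 1(1) 2(1)] by (auto simp: E_def)
    have opens: "openin (etop X) E1" "openin (etop X) E2" "openin (etop X) E"
      using exterior_space_openin[OF X] 1(1) 2(1) E(1) by auto
    note sub = opens[THEN openin_subset]
    define G where "G = {C \<in> path_components_of (subtopology (etop X) E).
                          \<exists>x\<in>C. q0_at X E1 x \<in> G1 \<and> q0_at X E2 x \<in> G2}"
    have same: "q0_at X F x = q0_at X F y" if "y \<in> q0_at X E x" "E \<subseteq> F" for F x y
      using that path_component_of_mono[of "etop X" E x y F]
      by (auto simp: path_component_of_equiv)
    have qG: "q0_at X E x \<in> G \<longleftrightarrow> q0_at X E1 x \<in> G1 \<and> q0_at X E2 x \<in> G2" if "x \<in> E" for x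
    proof -
      have "x \<in> topspace (subtopology (etop X) E)"
        using that sub by auto
      then have "q0_at X E x \<in> path_components_of (subtopology (etop X) E)" "x \<in> q0_at X E x"
        by (auto simp: path_components_of_def path_component_of_refl)
      then show ?thesis
        unfolding G_def using same[OF _ E(2)] same[OF _ E(3)] by (smt (verit) mem_Collect_eq)
    qed
    have pre: "{x \<in> topspace (subtopology (etop X) E). q0_at X E x \<in> G} =
               {x \<in> E1. q0_at X E1 x \<in> G1} \<inter> {x \<in> E2. q0_at X E2 x \<in> G2}"
      using qG sub by (auto simp: E_def)
    have o: "openin (etop X) {x \<in> F. q0_at X F x \<in> H}"
      if "openin (etop X) F" "openin (pi0_at X F) H" for F H
    proof -
      have "openin (subtopology (etop X) F) {x \<in> topspace (subtopology (etop X) F). q0_at X F x \<in> H}"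
        using that(2) by (simp add: openin_pi0)
      moreover have "{x \<in> topspace (subtopology (etop X) F). q0_at X F x \<in> H} = {x \<in> F. q0_at X F x \<in> H}"
        using openin_subset[OF that(1)] by auto
      ultimately show ?thesis
        using that(1) by (simp add: openin_open_subtopology)
    qed
    have "openin (subtopology (etop X) E) {x \<in> topspace (subtopology (etop X) E). q0_at X E x \<in> G}"
      unfolding pre openin_open_subtopology[OF opens(3)]
      using o[OF opens(1) 1(2)] o[OF opens(2) 2(2)] by (auto simp: E_def)
    then have openG: "openin (pi0_at X E) G"
      by (auto simp: openin_pi0 G_def)
    have bG: "b E \<in> G \<longleftrightarrow> b E1 \<in> G1 \<and> b E2 \<in> G2" if b: "b \<in> topspace (end_space X)" for b
    proof -
      have m: "b E \<in> path_components_of (subtopology (etop X) E)"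
        using end_space_proj[OF b E(1)] .
      then obtain x where "x \<in> b E"
        using nonempty_path_components_of by fastforce
      then show ?thesis
        unfolding G_def
        using m end_space_compat[OF b E(1) 1(1) E(2)] end_space_compat[OF b E(1) 2(1) E(3)]
        by auto
    qed
    show ?thesis
    proof (intro bexI[OF _ E(1)] exI[of _ G] conjI)
      show "{x \<in> E. q0_at X E x \<in> G} \<subseteq> p0_pre X (S \<inter> T)"
        using qG 1(5) 2(5) E p by fastforce
    qed (use openG bG 1(3,4) 2(3,4) i in auto)
  qed
  then show "completion_open X (S \<inter> T)"
    using S T p i by (auto simp: completion_open_def intro: openin_Int)
next
  fix \<K>
  assume K: "\<forall>K\<in>\<K>. completion_open X K"
  have p: "p0_pre X (\<Union>\<K>) = (\<Union>K\<in>\<K>. p0_pre X K)"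
    and i: "in0_pre X (\<Union>\<K>) = (\<Union>K\<in>\<K>. in0_pre X K)"
    by (auto simp: p0_pre_def in0_pre_def)
  have "openin (etop X) (p0_pre X (\<Union>\<K>))" "openin (end_space X) (in0_pre X (\<Union>\<K>))"
    unfolding p i using K by (auto simp: completion_open_def)
  moreover have "\<exists>E \<in> exts X. \<exists>G. openin (pi0_at X E) G \<and>
        a \<in> {b \<in> topspace (end_space X). b E \<in> G} \<and>
        {b \<in> topspace (end_space X). b E \<in> G} \<subseteq> in0_pre X (\<Union>\<K>) \<and>
        {x \<in> E. q0_at X E x \<in> G} \<subseteq> p0_pre X (\<Union>\<K>)"
    if "a \<in> in0_pre X (\<Union>\<K>)" for a
  proof -
    from that i obtain K' where K': "K' \<in> \<K>" "a \<in> in0_pre X K'"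
      by auto
    then have cK: "completion_open X K'"
      using K by auto
    obtain E G where EG: "E \<in> exts X" "openin (pi0_at X E) G"
        "a \<in> {b \<in> topspace (end_space X). b E \<in> G}"
        "{b \<in> topspace (end_space X). b E \<in> G} \<subseteq> in0_pre X K'"
        "{x \<in> E. q0_at X E x \<in> G} \<subseteq> p0_pre X K'"
      by (rule completion_openE[OF cK K'(2)])
    have "in0_pre X K' \<subseteq> in0_pre X (\<Union>\<K>)" "p0_pre X K' \<subseteq> p0_pre X (\<Union>\<K>)"
      unfolding p i using K'(1) by auto
    then show ?thesis
      by (intro bexI[OF _ EG(1)] exI[of _ G] conjI EG(2,3) order_trans[OF EG(4)] order_trans[OF EG(5)])
  qed
  ultimately show "completion_open X (\<Union>\<K>)"
    using K by (auto simp: completion_open_def)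
qed

lemma openin_completion:
  "exterior_space X \<Longrightarrow> openin (etop (C0_completion X)) W \<longleftrightarrow> completion_open X W"
  by (simp add: C0_completion_def istopology_completion_open topology_inverse')

end

theory Submission
  imports Defs
begin

text \<open>
  Completeness makes \<^const>\<open>p0\<close> bijective. A push-out along an injection is a disjoint union of
  the complement of the limit space with the end space, so this says that \<^const>\<open>e0\<close> is
  a bijection from the limit space onto the end space: a point of the limit space is determined by
  its path-components in the exterior open sets, and every end is represented in this way.

  Both halves are then used dynamically. Injectivity makes the limit space pointwise fixed: it is
  invariant under the flow, and an orbit inside it is connected by paths in every exterior open
  set, so all its points have the same image under \<^const>\<open>e0\<close> (\<open>flow_fixes_limit_space\<close>).
  Conversely a critical point is its own trajectory, which must enter every exterior open set.
  Surjectivity gives limits: the tail of a trajectory eventually lies in one path-component of each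
  exterior open set, hence defines an end, and condition (b) in the topology of the completion
  says exactly that the trajectory converges to the point of the limit space representing this end
  (\<open>trajectory_converges_to_limit_space\<close>). So every \<open>\<omega>\<close>-limit set meets the limit space.

  In a Hausdorff space the \<open>\<omega>\<close>-limit set of a convergent trajectory is the singleton of its limit.
  Therefore the union of all \<open>\<omega>\<close>-limit sets is the limit space, which is closed, being the set of
  critical points. Every global attractor contains that union, which gives minimality
  and uniqueness.
\<close>

section \<open>The end map of a complete exterior space\<close>

text \<open>The normal form that replaces a point of the limit space by its end is constant on
  generating pairs, hence on glued pairs.\<close>

lemma glue_normal_form:
  assumes "glue X u v"
  defines "f \<equiv> \<lambda>w. case w of Inl x \<Rightarrow> (if x \<in> limit_space X then Inr (e0 X x) else Inl x) | Inr a \<Rightarrow> Inr a"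
  shows "f u = f v"
  using assms(1) unfolding glue_def
  by (induction rule: equivclp_induct) (auto simp: f_def)

lemma glue_end_point:
  assumes "glue X (Inr a) (Inl x)"
  shows "x \<in> limit_space X" "e0 X x = a"
  using glue_normal_form[OF assms] by (auto split: if_splits)

lemma glue_refl: "glue X u u"
  by (simp add: glue_def)

lemma glue_class_eq: "glue X u v \<Longrightarrow> Collect (glue X u) = Collect (glue X v)"
proof (rule Collect_cong)
  assume uv: "glue X u v"
  show "glue X u w \<longleftrightarrow> glue X v w" for w
    using uv equivclp_trans[OF equivclp_sym[OF uv[unfolded glue_def]], of w]
      equivclp_trans[OF uv[unfolded glue_def], of w]
    unfolding glue_def by iprover
qed

lemma p0_eq_in0_e0: "x \<in> limit_space X \<Longrightarrow> p0 X x = in0 X (e0 X x)"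
  unfolding p0_def in0_def by (rule glue_class_eq) (auto simp: glue_def intro: r_into_equivclp)

lemma limit_space_subset_topspace:
  assumes "exterior_space X"
  shows "limit_space X \<subseteq> topspace (etop X)"
proof -
  obtain E where E: "E \<in> exts X"
    using assms by (auto simp: exterior_space_def)
  then show ?thesis
    using openin_subset[OF exterior_space_openin[OF assms E]] by (auto simp: limit_space_def)
qed

text \<open>The carrier is itself open, since the set of all path-components of any one exterior open set
  witnesses condition (b) at every end; there is such a set because externologies are nonempty.\<close>

lemma topspace_completion:
  assumes "exterior_space X"
  shows "topspace (etop (C0_completion X)) = completion_carrier X"
proof
  show "topspace (etop (C0_completion X)) \<subseteq> completion_carrier X"
    using openin_topspace[of "etop (C0_completion X)"]
    by (simp only: openin_completion[OF assms] completion_open_def)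
  have p: "p0_pre X (completion_carrier X) = topspace (etop X)"
    and i: "in0_pre X (completion_carrier X) = topspace (end_space X)"
    by (auto simp: p0_pre_def in0_pre_def completion_carrier_def)
  obtain E where E: "E \<in> exts X"
    using assms by (auto simp: exterior_space_def)
  have "E \<subseteq> topspace (etop X)"
    by (rule openin_subset[OF exterior_space_openin[OF assms E]])
  moreover have "openin (pi0_at X E) (path_components_of (subtopology (etop X) E))"
    by (metis openin_topspace topspace_pi0)
  ultimately have "completion_open X (completion_carrier X)"
    unfolding completion_open_def p i using E end_space_proj[OF _ E] by blast
  then show "completion_carrier X \<subseteq> topspace (etop (C0_completion X))"
    using openin_subset openin_completion[OF assms] by metis
qed

lemma complete_e0_inj_on:
  assumes "C0_complete X" "exterior_space X"
  shows "inj_on (e0 X) (limit_space X)"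
proof (rule inj_onI)
  fix x y assume xy: "x \<in> limit_space X" "y \<in> limit_space X" and "e0 X x = e0 X y"
  then have "p0 X x = p0 X y"
    by (simp add: p0_eq_in0_e0)
  then show "x = y"
    using assms(1) xy limit_space_subset_topspace[OF assms(2)]
    unfolding C0_complete_def exterior_iso_def by (metis subsetD)
qed

lemma complete_e0_surj:
  assumes "C0_complete X" "exterior_space X" "a \<in> topspace (end_space X)"
  obtains y where "y \<in> limit_space X" "e0 X y = a"
proof -
  obtain g where g: "exterior_map (C0_completion X) X g"
    "\<forall>c \<in> topspace (etop (C0_completion X)). p0 X (g c) = c"
    using assms(1) by (auto simp: C0_complete_def exterior_iso_def)
  have "in0 X a \<in> topspace (etop (C0_completion X))"
    using assms by (simp add: topspace_completion completion_carrier_def)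
  then have "p0 X (g (in0 X a)) = in0 X a"
    using g by blast
  then have "glue X (Inr a) (Inl (g (in0 X a)))"
    unfolding p0_def in0_def using glue_refl[of X] by blast
  then show thesis
    using that glue_end_point by metis
qed

text \<open>The topology of a complete exterior space near its limit space is determined by
  path-components of exterior open sets; this is condition (b) for the completion, pulled back
  along the homeomorphism \<^const>\<open>p0\<close>.\<close>

lemma complete_nbhd_limit_point:
  assumes "C0_complete X" "exterior_space X"
    and y: "y \<in> limit_space X" and ends: "e0 X y \<in> topspace (end_space X)"
    and U: "openin (etop X) U" "y \<in> U"
  obtains E where "E \<in> exts X" "\<And>z. z \<in> E \<Longrightarrow> q0_at X E z = q0_at X E y \<Longrightarrow> z \<in> U"
proof -
  obtain g where g: "exterior_map (C0_completion X) X g"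
    and gp: "\<forall>x \<in> topspace (etop X). g (p0 X x) = x"
    using assms(1) by (auto simp: C0_complete_def exterior_iso_def)
  define W where "W = {c \<in> topspace (etop (C0_completion X)). g c \<in> U}"
  have "openin (etop (C0_completion X)) W"
    using g U(1) unfolding exterior_map_def W_def by (auto intro: openin_continuous_map_preimage)
  then have W: "completion_open X W"
    by (simp add: openin_completion[OF assms(2)])
  have yX: "y \<in> topspace (etop X)"
    using y limit_space_subset_topspace[OF assms(2)] by blast
  have "p0 X y \<in> W"
    using yX U(2) gp by (simp add: W_def topspace_completion[OF assms(2)] completion_carrier_def)
  then have "e0 X y \<in> in0_pre X W"
    using ends y by (simp add: in0_pre_def p0_eq_in0_e0)
  then obtain E G where E: "E \<in> exts X" and G: "e0 X y E \<in> G"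
    and sub: "{x \<in> E. q0_at X E x \<in> G} \<subseteq> p0_pre X W"
    by (rule completion_openE[OF W]) (elim CollectE conjE, rule that)
  have "z \<in> U" if "z \<in> E" "q0_at X E z = q0_at X E y" for z
  proof -
    have "z \<in> p0_pre X W"
      using sub that G E by (auto simp: e0_def)
    then show ?thesis
      using gp by (auto simp: p0_pre_def W_def)
  qed
  then show thesis
    using that E by blast
qed

section \<open>Trajectories\<close>

lemma flow_continuous_trajectory:
  assumes "flow X \<phi>" "x \<in> topspace X"
  shows "continuous_map euclideanreal X (\<lambda>t. \<phi> t x)"
proof -
  have "continuous_map euclideanreal (prod_topology euclideanreal X) (\<lambda>t. (t, x))"
    using assms(2) by (simp add: continuous_map_pairedI)
  from continuous_map_compose[OF this, of X "\<lambda>(t, x). \<phi> t x"] show ?thesis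
    using assms(1) by (simp add: flow_def o_def)
qed

lemma flow_continuous_map:
  assumes "flow X \<phi>"
  shows "continuous_map X X (\<phi> t)"
proof -
  have "continuous_map X (prod_topology euclideanreal X) (\<lambda>x. (t, x))"
    by (simp add: continuous_map_pairedI)
  from continuous_map_compose[OF this, of X "\<lambda>(t, x). \<phi> t x"] show ?thesis
    using assms by (simp add: flow_def o_def)
qed

lemma trajectory_same_path_component:
  assumes "flow X \<phi>" "x \<in> topspace X" "convex S" "(\<lambda>t. \<phi> t x) ` S \<subseteq> E" "s \<in> S" "t \<in> S"
  shows "q0 (subtopology X E) (\<phi> s x) = q0 (subtopology X E) (\<phi> t x)"
proof -
  have "path_connectedin euclideanreal S"
    using assms(3) by (simp add: convex_imp_path_connected)
  then have "path_connectedin X ((\<lambda>t. \<phi> t x) ` S)"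
    using flow_continuous_trajectory[OF assms(1,2)] path_connectedin_continuous_map_image by blast
  then have "path_connectedin (subtopology X E) ((\<lambda>t. \<phi> t x) ` S)"
    using assms(4) by (simp add: path_connectedin_subtopology)
  then have "path_component_of (subtopology X E) (\<phi> s x) (\<phi> t x)"
    using assms(5,6) path_component_of_maximal[of "subtopology X E" "(\<lambda>t. \<phi> t x) ` S" "\<phi> s x"]
    by blast
  then show ?thesis
    by (simp add: path_component_of_equiv)
qed

lemma exterior_map_bar_prodE:
  assumes "exterior_map (bar_prod X Y) Z f" "E \<in> exts Z" "y \<in> topspace Y"
  obtains T where "T \<in> exts X" "\<And>x. x \<in> T \<Longrightarrow> f (x, y) \<in> E"
proof -
  define P where "P = {p \<in> topspace (etop (bar_prod X Y)). f p \<in> E}"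
  have "P \<in> exts (bar_prod X Y)"
    using assms(1,2) by (simp add: exterior_map_def P_def)
  then have "\<forall>y \<in> topspace Y. \<exists>U T. openin Y U \<and> y \<in> U \<and> T \<in> exts X \<and> T \<times> U \<subseteq> P"
    by (simp add: bar_prod_def)
  then obtain U T where "y \<in> U" "T \<in> exts X" "T \<times> U \<subseteq> P"
    using assms(3) by meson
  moreover from this have "f (x, y) \<in> E" if "x \<in> T" for x
    using that by (auto simp: P_def)
  ultimately show thesis
    using that by metis
qed

lemma trajectory_eventually_exterior:
  assumes "r_exterior_flow X \<phi>" "x \<in> topspace (etop X)" "E \<in> exts X"
  obtains T where "\<And>t. t > T \<Longrightarrow> \<phi> t x \<in> E"
proof -
  have "exterior_map (bar_prod R_r (discrete_topology (topspace (etop X)))) X (\<lambda>(t, x). \<phi> t x)"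
    using assms(1) by (simp add: r_exterior_flow_def)
  then obtain S where S: "S \<in> exts R_r" "\<And>t. t \<in> S \<Longrightarrow> (case (t, x) of (t, x) \<Rightarrow> \<phi> t x) \<in> E"
    by (rule exterior_map_bar_prodE[where y = x, OF _ assms(3)]) (use assms(2) in auto)
  then obtain n :: nat where "{real n<..} \<subseteq> S"
    by (auto simp: R_r_def)
  then show thesis
    using S(2) by (intro that[of "real n"]) auto
qed

lemma flow_limit_space_invariant:
  assumes "r_exterior_flow X \<phi>" "x \<in> limit_space X"
  shows "\<phi> t x \<in> limit_space X"
  unfolding limit_space_def
proof (rule InterI)
  fix E assume E: "E \<in> exts X"
  have "exterior_map (bar_prod X (top_of_set {0..1::real})) X (\<lambda>(x, s). \<phi> (t * s) x)"
    using assms(1) by (simp add: r_exterior_flow_def)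
  then obtain T where "T \<in> exts X" "\<And>z. z \<in> T \<Longrightarrow> (case (z, 1) of (x, s) \<Rightarrow> \<phi> (t * s) x) \<in> E"
    by (rule exterior_map_bar_prodE[where y = 1, OF _ E]) auto
  then show "\<phi> t x \<in> E"
    using assms(2) by (auto simp: limit_space_def)
qed

text \<open>An orbit in the limit space is a path in every exterior open set, so it cannot leave a fibre
  of \<^const>\<open>e0\<close>; in the complete case these fibres are points.\<close>

lemma flow_fixes_limit_space:
  assumes "r_exterior_flow X \<phi>" "C0_complete X" "x \<in> limit_space X"
  shows "\<phi> t x = x"
proof -
  have X: "exterior_space X" and fl: "flow (etop X) \<phi>"
    using assms(1) by (auto simp: r_exterior_flow_def)
  have xX: "x \<in> topspace (etop X)"
    using assms(3) limit_space_subset_topspace[OF X] by blast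
  have L: "\<phi> s x \<in> limit_space X" for s
    using flow_limit_space_invariant[OF assms(1,3)] .
  have "q0_at X E (\<phi> t x) = q0_at X E (\<phi> 0 x)" if "E \<in> exts X" for E
  proof (rule trajectory_same_path_component[OF fl xX convex_UNIV])
    show "range (\<lambda>t. \<phi> t x) \<subseteq> E"
      using L that by (auto simp: limit_space_def)
  qed simp_all
  then have "e0 X (\<phi> t x) = e0 X (\<phi> 0 x)"
    by (simp add: e0_def restrict_def fun_eq_iff)
  then have "\<phi> t x = \<phi> 0 x"
    using complete_e0_inj_on[OF assms(2) X] L by (auto dest: inj_onD)
  then show ?thesis
    using fl xX by (simp add: flow_def)
qed

lemma critical_points_subset_limit_space:
  assumes "r_exterior_flow X \<phi>"
  shows "critical_points (etop X) \<phi> \<subseteq> limit_space X"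
proof
  fix x assume x: "x \<in> critical_points (etop X) \<phi>"
  have "x \<in> E" if E: "E \<in> exts X" for E
  proof -
    obtain T where "\<And>t. t > T \<Longrightarrow> \<phi> t x \<in> E"
      using trajectory_eventually_exterior[OF assms _ E, of x] x
      by (auto simp: critical_points_def)
    from this[of "T + 1"] show ?thesis
      using x by (simp add: critical_points_def)
  qed
  then show "x \<in> limit_space X"
    by (simp add: limit_space_def)
qed

lemma limit_space_eq_critical_points:
  assumes "r_exterior_flow X \<phi>" "C0_complete X"
  shows "limit_space X = critical_points (etop X) \<phi>"
proof
  show "limit_space X \<subseteq> critical_points (etop X) \<phi>"
    using flow_fixes_limit_space[OF assms] limit_space_subset_topspace[of X] assms(1)
    by (auto simp: critical_points_def r_exterior_flow_def)
qed (rule critical_points_subset_limit_space[OF assms(1)])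

text \<open>The tail of a trajectory in an exterior open set is path-connected, so it singles out one
  path-component, and it does so compatibly for nested exterior open sets.\<close>

lemma trajectory_end:
  assumes "r_exterior_flow X \<phi>" "x \<in> topspace (etop X)"
  obtains a where "a \<in> topspace (end_space X)"
    "\<And>E. E \<in> exts X \<Longrightarrow> \<forall>\<^sub>F t in at_top. \<phi> t x \<in> E \<and> q0_at X E (\<phi> t x) = a E"
proof -
  have X: "exterior_space X" and fl: "flow (etop X) \<phi>"
    using assms(1) by (auto simp: r_exterior_flow_def)
  have "\<forall>E. \<exists>T. E \<in> exts X \<longrightarrow> (\<forall>t>T. \<phi> t x \<in> E)"
    using trajectory_eventually_exterior[OF assms] by metis
  then obtain T where T: "\<And>E t. E \<in> exts X \<Longrightarrow> t > T E \<Longrightarrow> \<phi> t x \<in> E"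
    by metis
  \<comment> \<open>Any time after \<open>T E\<close> would serve to pick out the component of the tail.\<close>
  define a where "a = (\<lambda>E \<in> exts X. q0_at X E (\<phi> (T E + 1) x))"
  have tail: "q0_at X E (\<phi> t x) = a E" if "E \<in> exts X" "t > T E" for E t
    using trajectory_same_path_component[OF fl assms(2), of "{T E<..}" E t "T E + 1"] T that
    by (auto simp: a_def)
  have ev: "\<forall>\<^sub>F t in at_top. \<phi> t x \<in> E \<and> q0_at X E (\<phi> t x) = a E" if "E \<in> exts X" for E
    using eventually_gt_at_top[of "T E"] by eventually_elim (use T tail that in blast)
  have comp: "a E \<in> path_components_of (subtopology (etop X) E)" if "E \<in> exts X" for E
    using T[OF that, of "T E + 1"] openin_subset[OF exterior_space_openin[OF X that]] that
    by (auto simp: a_def path_components_of_def)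
  have "q0_at X F z = a F" if EF: "E \<in> exts X" "F \<in> exts X" "E \<subseteq> F" and z: "z \<in> a E" for E F z
  proof -
    obtain t where t: "q0_at X E (\<phi> t x) = a E" "q0_at X F (\<phi> t x) = a F"
      using eventually_happens[OF eventually_conj[OF ev[OF EF(1)] ev[OF EF(2)]]] by auto
    have "path_component_of (subtopology (etop X) E) (\<phi> t x) z"
      using z t(1) by blast
    then have "path_component_of (subtopology (etop X) F) (\<phi> t x) z"
      using path_component_of_mono EF(3) by metis
    then show ?thesis
      using t(2) by (simp add: path_component_of_equiv)
  qed
  then have "a \<in> topspace (end_space X)"
    using comp by (auto simp: end_space_def a_def PiE_iff)
  then show thesis
    using that ev by blast
qed

lemma trajectory_converges_to_limit_space:
  assumes "r_exterior_flow X \<phi>" "C0_complete X" "x \<in> topspace (etop X)"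
  obtains y where "y \<in> limit_space X" "limitin (etop X) (\<lambda>t. \<phi> t x) y at_top"
proof -
  have X: "exterior_space X"
    using assms(1) by (simp add: r_exterior_flow_def)
  obtain a where a: "a \<in> topspace (end_space X)"
    and ev: "\<And>E. E \<in> exts X \<Longrightarrow> \<forall>\<^sub>F t in at_top. \<phi> t x \<in> E \<and> q0_at X E (\<phi> t x) = a E"
    using trajectory_end[OF assms(1,3)] by blast
  obtain y where y: "y \<in> limit_space X" "e0 X y = a"
    using complete_e0_surj[OF assms(2) X a] .
  have "\<forall>\<^sub>F t in at_top. \<phi> t x \<in> U" if U: "openin (etop X) U" "y \<in> U" for U
  proof -
    obtain E where E: "E \<in> exts X" and near: "\<And>z. z \<in> E \<Longrightarrow> q0_at X E z = q0_at X E y \<Longrightarrow> z \<in> U"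
      using complete_nbhd_limit_point[OF assms(2) X y(1) _ U] a y(2) by metis
    have "a E = q0_at X E y"
      using y(2) E by (auto simp: e0_def)
    then show ?thesis
      using ev[OF E] by (auto elim!: eventually_mono intro: near)
  qed
  then have "limitin (etop X) (\<lambda>t. \<phi> t x) y at_top"
    using y(1) limit_space_subset_topspace[OF X] by (auto simp: limitin_def)
  then show thesis
    using that y(1) by blast
qed

section \<open>Limit sets and attractors\<close>

lemma limit_in_omega_r:
  assumes "limitin X (\<lambda>t. \<phi> t x) y at_top"
  shows "y \<in> omega_r X \<phi> x"
proof -
  have "\<exists>s\<ge>t. \<phi> s x \<in> U" if "openin X U" "y \<in> U" for t U
  proof -
    have "\<forall>\<^sub>F s in at_top. \<phi> s x \<in> U"
      using assms that by (auto simp: limitin_def)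
    then show ?thesis
      using eventually_happens[OF eventually_conj[OF _ eventually_ge_at_top[of t]]] by auto
  qed
  then show ?thesis
    using limitin_topspace[OF assms] by (fastforce simp: omega_r_def in_closure_of)
qed

lemma omega_r_eq_limit:
  assumes "Hausdorff_space X" "limitin X (\<lambda>t. \<phi> t x) y at_top"
  shows "omega_r X \<phi> x = {y}"
proof -
  have "z = y" if z: "z \<in> omega_r X \<phi> x" for z
  proof (rule ccontr)
    assume "z \<noteq> y"
    have tails: "z \<in> X closure_of ((\<lambda>s. \<phi> s x) ` {t..})" if "t \<ge> 0" for t
      using z that by (auto simp: omega_r_def)
    then have "z \<in> topspace X"
      using in_closure_of order_refl by metis
    then obtain U V where U: "openin X U" "y \<in> U" and V: "openin X V" "z \<in> V" and "disjnt U V"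
      using assms(1) limitin_topspace[OF assms(2)] \<open>z \<noteq> y\<close> unfolding Hausdorff_space_def by metis
    obtain T where T: "\<And>t. t \<ge> T \<Longrightarrow> \<phi> t x \<in> U"
      using assms(2) U unfolding limitin_def eventually_at_top_linorder by blast
    have "z \<in> X closure_of ((\<lambda>s. \<phi> s x) ` {max 0 T..})"
      by (rule tails) simp
    then obtain s where "s \<ge> max 0 T" "\<phi> s x \<in> V"
      using V by (auto simp: in_closure_of)
    then show False
      using T[of s] \<open>disjnt U V\<close> by (auto simp: disjnt_def)
  qed
  then show ?thesis
    using limit_in_omega_r[of X \<phi> x y] assms(2) by blast
qed

lemma critical_points_subset_Omega_r: "critical_points X \<phi> \<subseteq> Omega_r X \<phi>"
proof
  fix x assume x: "x \<in> critical_points X \<phi>"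
  then have "x \<in> omega_r X \<phi> x"
    by (intro limit_in_omega_r) (simp add: critical_points_def limitin_def)
  then show "x \<in> Omega_r X \<phi>"
    using x by (auto simp: Omega_r_def critical_points_def)
qed

lemma closedin_critical_points:
  assumes "flow X \<phi>" "Hausdorff_space X"
  shows "closedin X (critical_points X \<phi>)"
proof -
  have "closedin X {x \<in> topspace X. \<phi> t x = x}" for t
    by (rule closedin_continuous_maps_eq[OF assms(2) flow_continuous_map[OF assms(1)]]) simp
  moreover have "critical_points X \<phi> = (\<Inter>t. {x \<in> topspace X. \<phi> t x = x})"
    by (auto simp: critical_points_def)
  ultimately show ?thesis
    by auto
qed

lemma Omega_r_subset_global_attractor:
  "global_attractor X \<phi> M \<Longrightarrow> Omega_r X \<phi> \<subseteq> M"
  by (auto simp: global_attractor_def Omega_r_def)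

theorem corollary5p1:
  fixes X :: "'a exterior" and \<phi> :: "real \<Rightarrow> 'a \<Rightarrow> 'a"
  assumes "r_exterior_flow X \<phi>" and "C0_complete X"
  shows "(global_weak_attractor (etop X) \<phi> (limit_space X) \<and>
          limit_space X = critical_points (etop X) \<phi>) \<and>
         (Hausdorff_space (etop X) \<longrightarrow>
           minimal_global_attractor (etop X) \<phi> (limit_space X) \<and>
           (\<forall>M. minimal_global_attractor (etop X) \<phi> M \<longrightarrow> M = limit_space X) \<and>
           limit_space X = etop X closure_of Omega_r (etop X) \<phi>)"
proof -
  let ?L = "limit_space X" and ?T = "etop X"
  have X: "exterior_space X" and fl: "flow ?T \<phi>"
    using assms(1) by (auto simp: r_exterior_flow_def)
  have crit: "?L = critical_points ?T \<phi>"
    by (rule limit_space_eq_critical_points[OF assms])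
  have inv: "invariant_subspace ?T \<phi> ?L"
    using limit_space_subset_topspace[OF X] flow_limit_space_invariant[OF assms(1)]
    by (auto simp: invariant_subspace_def)
  have conv: "\<exists>y \<in> ?L. limitin ?T (\<lambda>t. \<phi> t x) y at_top" if "x \<in> topspace ?T" for x
    using trajectory_converges_to_limit_space[OF assms that] by blast
  have weak: "global_weak_attractor ?T \<phi> ?L"
    unfolding global_weak_attractor_def using inv conv limit_in_omega_r by fastforce
  have "minimal_global_attractor ?T \<phi> ?L \<and>
      (\<forall>M. minimal_global_attractor ?T \<phi> M \<longrightarrow> M = ?L) \<and> ?L = ?T closure_of Omega_r ?T \<phi>"
    if H: "Hausdorff_space ?T"
  proof -
    have omega: "\<exists>y \<in> ?L. omega_r ?T \<phi> x = {y}" if "x \<in> topspace ?T" for x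
      using conv[OF that] omega_r_eq_limit[OF H] by metis
    have attr: "global_attractor ?T \<phi> ?L"
      unfolding global_attractor_def using inv omega by fastforce
    have "?L \<subseteq> Omega_r ?T \<phi>"
      unfolding crit by (rule critical_points_subset_Omega_r)
    then have Om: "Omega_r ?T \<phi> = ?L"
      using Omega_r_subset_global_attractor[OF attr] by blast
    have least: "?L \<subseteq> M" if "global_attractor ?T \<phi> M" for M
      using Omega_r_subset_global_attractor[OF that] Om by blast
    have "?T closure_of ?L = ?L"
      using closedin_critical_points[OF fl H] crit by (simp add: closure_of_closedin)
    then show ?thesis
      unfolding minimal_global_attractor_def Om using attr least by blast
  qed
  then show ?thesis
    using weak crit by blast
qed

end
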